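(* Let $\mathcal{Q}$ be a quantale (as in the context), let $J$ be a saturated class of weights, and let $X$ be a $\mathcal{Q}$-category. The following are equivalent: (i) $X$ is $J$-continuous; (ii) the way-below $\mathcal{Q}$-distributor $\Downarrow\colon X\to X$ is approximating; (iii) there exists a $J$-cocontinuous approximating $\mathcal{Q}$-distributor $v\colon X\to X$.
   Context: A quantale $\mathcal{Q}=(Q,\leqslant,\otimes,\mathbf{1})$ is here a completely distributive complete lattice with a commutative monoid structure $(\otimes,\mathbf 1)$ such that $\otimes$ preserves arbitrary suprema in each variable, $\mathbf 1$ is the greatest element and $\bot\neq\mathbf 1$. Write $Q(a,b)=\bigvee\{c\mid a\otimes c\leqslant b\}$. A $\mathcal{Q}$-category is a set $X$ with a map $X\colon X\times X\to Q$ with $\mathbf 1\leqslant X(x,x)$ and $X(x,y)\otimes X(y,z)\leqslant X(x,z)$. A $\mathcal{Q}$-functor $f\colon X\to Y$ is a map with $X(x,y)\leqslant Y(fx,fy)$. $\mathcal{Q}$-functors are ordered by $f\leqslant g$ iff $\mathbf 1\leqslant Y(fx,gx)$ for all $x$; $f\cong g$ means $f\leqslant g$ and $g\leqslant f$; $f\dashv g$ ($f\colon X\to Y$, $g\colon Y\to X$) means $Y(fx,y)=X(x,gy)$ for all $x,y$. A $\mathcal{Q}$-distributor from $X$ to $Y$ is a map $\varphi\colon X\times Y\to Q$ with $X(x',x)\otimes\varphi(x,y)\otimes Y(y,y')\leqslant\varphi(x',y')$; distributors are ordered pointwise, composed by $(\psi\cdot\varphi)(x,z)=\bigvee_{y}\varphi(x,y)\otimes\psi(y,z)$,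 with the structure $X(-,-)$ (also written $X$) as identity. For a $\mathcal{Q}$-functor $f\colon X\to Y$, $f_*(x,y)=Y(fx,y)$ is a distributor from $X$ to $Y$ and $f^*(y,x)=Y(y,fx)$ one from $Y$ to $X$. Let $1$ be the one-point $\mathcal{Q}$-category (with structure constantly $\mathbf 1$). $\widehat X$ is the set of distributors $\varphi$ from $X$ to $1$ (viewed as maps $X\to Q$) with $\widehat X(\varphi,\psi)=\bigwedge_{x}Q(\varphi x,\psi x)$. For $x\in X$, $x^*=X(-,x)\in\widehat X$; the Yoneda functor is $\mathsf y\colon X\to\widehat X$, $x\mapsto x^*$. A saturated class of weights $J$ assigns to each $\mathcal{Q}$-category $X$ a subset $JX\subseteq\widehat X$ containing every $x^*$, such that, writing $\varphi\in J$ for a distributor $\varphi$ from $X$ to $Y$ with $\varphi(-,y)\in JX$ for all $y\in Y$, the class of distributors in $J$ is closed under composition. $J_SX$ is the set (full sub-$\mathcal{Q}$-category of $\widehat X$) of those $\varphi\in JX$ having a supremum, i.e. an element $\mathcal S\varphi\in X$ with $X(\mathcal S\varphi,x)=\widehat X(\varphi,\mathsf y x)$ for all $x\in X$. Suprema are unique up to equivalence ($x\cong y$ iff $\mathbf 1\leqslant X(x,y)$ and $\mathbf 1\leqslant X(y,x)$); $\mathcal S\colon J_SX\to X$ denotes the resulting $\mathcal{Q}$-functor (a fixed choice of suprema). One has $x^*\in J_SX$, so $\mathsf y\colon X\to J_SX$, and $\mathsf y_*(x,\psi)=\psi(x)$, $\mathcal S^*(x,\psi)=X(x,\mathcal S\psi)$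 are distributors from $X$ to $J_SX$. $X$ is $J$-continuous if $\mathcal S\colon J_SX\to X$ has a left adjoint ($\mathcal{Q}$-functor $X\to J_SX$). The way-below distributor $\Downarrow$ on $X$ is the largest distributor $v$ from $X$ to $X$ with $\mathcal S^*\cdot v\leqslant\mathsf y_*$; explicitly $\Downarrow(z,x)=\bigwedge_{\psi\in J_SX}Q(X(x,\mathcal S\psi),\psi(z))$. A distributor $v$ from $X$ to $X$ is approximating if $v\in J$ and $\bigwedge_{z\in X}Q(v(z,x),X(z,y))=X(x,y)$ for all $x,y\in X$. A distributor $v$ from $X$ to $Y$ is $J$-cocontinuous if $\mathcal S^*\cdot v=\mathsf y_*\cdot v$, where $\mathcal S\colon J_SY\to Y$ and $\mathsf y\colon Y\to J_SY$. *)

theory Defs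
  imports "HOL-Library.FuncSet"
begin

(* complete_distrib_lattice is complete distributivity for arbitrary families, not just the
   frame and coframe laws.  The tensor is multiplication, its unit is 1. *)
class quantale = complete_distrib_lattice + comm_monoid_mult +
  assumes mult_Sup: "a * Sup B = (SUP b\<in>B. a * b)"
    and one_eq_top: "1 = top"
    and bot_neq_one: "bot \<noteq> 1"

definition residual :: "'q::quantale \<Rightarrow> 'q \<Rightarrow> 'q" where
  "residual a b = Sup {c. a * c \<le> b}"

record ('a, 'q) qcat =
  obj :: "'a set"
  hom :: "'a \<Rightarrow> 'a \<Rightarrow> 'q"

(* The last clause only normalises hom off its domain, so that equal Q-categories are equal as
   records; a class of weights, being a function on records, therefore cannot tell apart two
   representations of one Q-category. *)
definition qcategory :: "('a, 'q::quantale) qcat \<Rightarrow> bool" where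
  "qcategory X \<longleftrightarrow>
     (\<forall>x\<in>obj X. 1 \<le> hom X x x) \<and>
     (\<forall>x\<in>obj X. \<forall>y\<in>obj X. \<forall>z\<in>obj X. hom X x y * hom X y z \<le> hom X x z) \<and>
     (\<forall>x y. x \<notin> obj X \<or> y \<notin> obj X \<longrightarrow> hom X x y = undefined)"

definition one_cat :: "(unit, 'q::quantale) qcat" where
  "one_cat = \<lparr>obj = UNIV, hom = (\<lambda>_ _. 1)\<rparr>"

definition full_sub :: "('a, 'q::quantale) qcat \<Rightarrow> 'a set \<Rightarrow> ('a, 'q) qcat" where
  "full_sub X A =
     \<lparr>obj = A, hom = (\<lambda>x y. if x \<in> A \<and> y \<in> A then hom X x y else undefined)\<rparr>"

definition qfunctor :: "('a, 'q::quantale) qcat \<Rightarrow> ('b, 'q) qcat \<Rightarrow> ('a \<Rightarrow> 'b) \<Rightarrow> bool" where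
  "qfunctor X Y f \<longleftrightarrow>
     f \<in> obj X \<rightarrow> obj Y \<and> (\<forall>x\<in>obj X. \<forall>y\<in>obj X. hom X x y \<le> hom Y (f x) (f y))"

definition left_adjoint ::
  "('a, 'q::quantale) qcat \<Rightarrow> ('b, 'q) qcat \<Rightarrow> ('a \<Rightarrow> 'b) \<Rightarrow> ('b \<Rightarrow> 'a) \<Rightarrow> bool" where
  "left_adjoint X Y f g \<longleftrightarrow>
     qfunctor X Y f \<and> qfunctor Y X g \<and>
     (\<forall>x\<in>obj X. \<forall>y\<in>obj Y. hom Y (f x) y = hom X x (g y))"

(* Values of a distributor outside obj X \<times> obj Y are irrelevant: distributors are compared only
   through dist_le and dist_eq. *)
definition distributor ::
  "('a, 'q::quantale) qcat \<Rightarrow> ('b, 'q) qcat \<Rightarrow> ('a \<Rightarrow> 'b \<Rightarrow> 'q) \<Rightarrow> bool" where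
  "distributor X Y \<phi> \<longleftrightarrow>
     (\<forall>x'\<in>obj X. \<forall>x\<in>obj X. \<forall>y\<in>obj Y. \<forall>y'\<in>obj Y.
        hom X x' x * \<phi> x y * hom Y y y' \<le> \<phi> x' y')"

definition dist_le ::
  "('a, 'q::quantale) qcat \<Rightarrow> ('b, 'q) qcat \<Rightarrow> ('a \<Rightarrow> 'b \<Rightarrow> 'q) \<Rightarrow> ('a \<Rightarrow> 'b \<Rightarrow> 'q) \<Rightarrow> bool" where
  "dist_le X Y \<phi> \<psi> \<longleftrightarrow> (\<forall>x\<in>obj X. \<forall>y\<in>obj Y. \<phi> x y \<le> \<psi> x y)"

definition dist_eq ::
  "('a, 'q::quantale) qcat \<Rightarrow> ('b, 'q) qcat \<Rightarrow> ('a \<Rightarrow> 'b \<Rightarrow> 'q) \<Rightarrow> ('a \<Rightarrow> 'b \<Rightarrow> 'q) \<Rightarrow> bool" where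
  "dist_eq X Y \<phi> \<psi> \<longleftrightarrow> (\<forall>x\<in>obj X. \<forall>y\<in>obj Y. \<phi> x y = \<psi> x y)"

(* dist_comp Y \<psi> \<phi> is \<psi> \<cdot> \<phi> for \<phi> from X to Y and \<psi> from Y to Z. *)
definition dist_comp ::
  "('b, 'q::quantale) qcat \<Rightarrow> ('b \<Rightarrow> 'c \<Rightarrow> 'q) \<Rightarrow> ('a \<Rightarrow> 'b \<Rightarrow> 'q) \<Rightarrow> 'a \<Rightarrow> 'c \<Rightarrow> 'q" where
  "dist_comp Y \<psi> \<phi> x z = (SUP y\<in>obj Y. \<phi> x y * \<psi> y z)"

(* f_* from X to Y and f^* from Y to X, for f from X to Y *)
definition graph :: "('b, 'q::quantale) qcat \<Rightarrow> ('a \<Rightarrow> 'b) \<Rightarrow> 'a \<Rightarrow> 'b \<Rightarrow> 'q" where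
  "graph Y f x y = hom Y (f x) y"

definition cograph :: "('b, 'q::quantale) qcat \<Rightarrow> ('a \<Rightarrow> 'b) \<Rightarrow> 'b \<Rightarrow> 'a \<Rightarrow> 'q" where
  "cograph Y f y x = hom Y y (f x)"

(* Presheaves are functions on obj X, i.e. total functions in extensional (obj X), so that each
   one is represented exactly once. *)
definition presheaf :: "('a, 'q::quantale) qcat \<Rightarrow> ('a \<Rightarrow> 'q) \<Rightarrow> bool" where
  "presheaf X \<phi> \<longleftrightarrow> \<phi> \<in> extensional (obj X) \<and> distributor X one_cat (\<lambda>x _. \<phi> x)"

definition presheaf_cat :: "('a, 'q::quantale) qcat \<Rightarrow> ('a \<Rightarrow> 'q, 'q) qcat" where
  "presheaf_cat X =
     \<lparr>obj = {\<phi>. presheaf X \<phi>},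
      hom = (\<lambda>\<phi> \<psi>. if presheaf X \<phi> \<and> presheaf X \<psi>
                    then (INF x\<in>obj X. residual (\<phi> x) (\<psi> x)) else undefined)\<rparr>"

definition yoneda :: "('a, 'q::quantale) qcat \<Rightarrow> 'a \<Rightarrow> 'a \<Rightarrow> 'q" where
  "yoneda X x = (\<lambda>z\<in>obj X. hom X z x)"

(* J assigns weights to all Q-categories whose objects form a subset of the type 'u, which plays
   the role of the universe of sets and is arbitrary. *)
definition in_class ::
  "(('u, 'q) qcat \<Rightarrow> ('u \<Rightarrow> 'q) set) \<Rightarrow> ('u, 'q::quantale) qcat \<Rightarrow> ('u, 'q) qcat
     \<Rightarrow> ('u \<Rightarrow> 'u \<Rightarrow> 'q) \<Rightarrow> bool" where
  "in_class J X Y \<phi> \<longleftrightarrow>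
     distributor X Y \<phi> \<and> (\<forall>y\<in>obj Y. (\<lambda>x\<in>obj X. \<phi> x y) \<in> J X)"

definition saturated_class :: "(('u, 'q::quantale) qcat \<Rightarrow> ('u \<Rightarrow> 'q) set) \<Rightarrow> bool" where
  "saturated_class J \<longleftrightarrow>
     (\<forall>X. qcategory X \<longrightarrow> J X \<subseteq> obj (presheaf_cat X) \<and> yoneda X ` obj X \<subseteq> J X) \<and>
     (\<forall>X Y Z \<phi> \<psi>. qcategory X \<longrightarrow> qcategory Y \<longrightarrow> qcategory Z \<longrightarrow>
        in_class J X Y \<phi> \<longrightarrow> in_class J Y Z \<psi> \<longrightarrow> in_class J X Z (dist_comp Y \<psi> \<phi>))"

definition is_supremum :: "('a, 'q::quantale) qcat \<Rightarrow> ('a \<Rightarrow> 'q) \<Rightarrow> 'a \<Rightarrow> bool" where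
  "is_supremum X \<phi> s \<longleftrightarrow>
     s \<in> obj X \<and> (\<forall>x\<in>obj X. hom X s x = hom (presheaf_cat X) \<phi> (yoneda X x))"

definition supremum :: "('a, 'q::quantale) qcat \<Rightarrow> ('a \<Rightarrow> 'q) \<Rightarrow> 'a" where
  "supremum X \<phi> = (SOME s. is_supremum X \<phi> s)"

definition JS ::
  "(('u, 'q::quantale) qcat \<Rightarrow> ('u \<Rightarrow> 'q) set) \<Rightarrow> ('u, 'q) qcat \<Rightarrow> ('u \<Rightarrow> 'q, 'q) qcat" where
  "JS J X = full_sub (presheaf_cat X) {\<phi> \<in> J X. \<exists>s. is_supremum X \<phi> s}"

definition J_continuous ::
  "(('u, 'q::quantale) qcat \<Rightarrow> ('u \<Rightarrow> 'q) set) \<Rightarrow> ('u, 'q) qcat \<Rightarrow> bool" where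
  "J_continuous J X \<longleftrightarrow> (\<exists>t. left_adjoint X (JS J X) t (supremum X))"

(* way_below_greatest below: this is the largest distributor v from X to X with
   S^* \<cdot> v \<le> y_*. *)
definition way_below ::
  "(('u, 'q::quantale) qcat \<Rightarrow> ('u \<Rightarrow> 'q) set) \<Rightarrow> ('u, 'q) qcat \<Rightarrow> 'u \<Rightarrow> 'u \<Rightarrow> 'q" where
  "way_below J X z x = (INF \<psi>\<in>obj (JS J X). residual (hom X x (supremum X \<psi>)) (\<psi> z))"

definition approximating ::
  "(('u, 'q::quantale) qcat \<Rightarrow> ('u \<Rightarrow> 'q) set) \<Rightarrow> ('u, 'q) qcat \<Rightarrow> ('u \<Rightarrow> 'u \<Rightarrow> 'q) \<Rightarrow> bool" where
  "approximating J X v \<longleftrightarrow>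
     in_class J X X v \<and>
     (\<forall>x\<in>obj X. \<forall>y\<in>obj X. (INF z\<in>obj X. residual (v z x) (hom X z y)) = hom X x y)"

(* For v from X to Y, S and y being those of Y; both sides are distributors from X to JS J Y. *)
definition J_cocontinuous ::
  "(('u, 'q::quantale) qcat \<Rightarrow> ('u \<Rightarrow> 'q) set) \<Rightarrow> ('u, 'q) qcat \<Rightarrow> ('u, 'q) qcat
     \<Rightarrow> ('u \<Rightarrow> 'u \<Rightarrow> 'q) \<Rightarrow> bool" where
  "J_cocontinuous J X Y v \<longleftrightarrow>
     distributor X Y v \<and>
     dist_eq X (JS J Y)
       (dist_comp Y (cograph Y (supremum Y)) v)
       (dist_comp Y (graph (JS J Y) (yoneda Y)) v)"


lemma mult_mono_q: "a \<le> b \<Longrightarrow> c * a \<le> c * (b::'q::quantale)"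
proof -
  assume "a \<le> b"
  then have "b = Sup {a, b}" by (simp add: sup.absorb2)
  then have "c * b = (SUP x\<in>{a,b}. c * x)" using mult_Sup by metis
  then show "c * a \<le> c * b" by (simp add: le_iff_sup)
qed

lemma mult_mono_q2: "a \<le> b \<Longrightarrow> c \<le> d \<Longrightarrow> a * c \<le> b * (d::'q::quantale)"
  by (metis mult_mono_q mult.commute order.trans)

lemma residual_galois: "c \<le> residual a b \<longleftrightarrow> a * c \<le> (b::'q::quantale)"
proof
  assume "c \<le> residual a b"
  then have "a * c \<le> a * Sup {c. a * c \<le> b}"
    unfolding residual_def by (rule mult_mono_q)
  also have "\<dots> \<le> b" by (auto simp: mult_Sup intro: SUP_least)
  finally show "a * c \<le> b" .
qed (auto simp: residual_def intro: Sup_upper)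

lemma presheaf_iff:
  "presheaf X \<phi> \<longleftrightarrow> \<phi> \<in> extensional (obj X) \<and>
     (\<forall>x'\<in>obj X. \<forall>x\<in>obj X. hom X x' x * \<phi> x \<le> (\<phi> x' :: 'q::quantale))"
  by (auto simp: presheaf_def distributor_def one_cat_def)

lemma presheaf_yoneda: "qcategory X \<Longrightarrow> x \<in> obj X \<Longrightarrow> presheaf X (yoneda X x)"
  by (auto simp: presheaf_iff yoneda_def qcategory_def)

lemma yoneda_lemma:
  assumes X: "qcategory X" "x \<in> obj X" and p: "presheaf X \<psi>"
  shows "hom (presheaf_cat X) (yoneda X x) \<psi> = \<psi> x"
proof -
  have "(INF z\<in>obj X. residual (yoneda X x z) (\<psi> z)) = \<psi> x" (is "?L = _")
  proof (rule order.antisym)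
    have "?L \<le> residual (hom X x x) (\<psi> x)"
      using X by (auto intro!: INF_lower2[of x] simp: yoneda_def)
    then have "hom X x x * ?L \<le> \<psi> x" by (simp add: residual_galois)
    moreover have "1 * ?L \<le> hom X x x * ?L"
      using X by (intro mult_mono_q2) (auto simp: qcategory_def)
    ultimately show "?L \<le> \<psi> x" by simp
    show "\<psi> x \<le> ?L"
      using X p by (auto intro!: INF_greatest simp: residual_galois yoneda_def presheaf_iff)
  qed
  then show ?thesis using presheaf_yoneda[OF X] p by (simp add: presheaf_cat_def)
qed

lemma is_supremum_yoneda:
  assumes X: "qcategory X" "x \<in> obj X"
  shows "is_supremum X (yoneda X x) x"
  unfolding is_supremum_def
proof (intro conjI ballI)
  fix y assume y: "y \<in> obj X"
  show "hom X x y = hom (presheaf_cat X) (yoneda X x) (yoneda X y)"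
    using yoneda_lemma[OF X presheaf_yoneda[OF X(1) y]] X by (simp add: yoneda_def)
qed (use X in auto)

lemma JS_obj:
  assumes "saturated_class J" "qcategory X" "\<psi> \<in> obj (JS J X)"
  shows "\<psi> \<in> J X" "presheaf X \<psi>" "is_supremum X \<psi> (supremum X \<psi>)" "supremum X \<psi> \<in> obj X"
proof -
  show "\<psi> \<in> J X" and s: "is_supremum X \<psi> (supremum X \<psi>)"
    using assms(3) by (auto simp: JS_def full_sub_def supremum_def intro: someI)
  then show "presheaf X \<psi>"
    using assms(1,2) unfolding saturated_class_def by (auto simp: presheaf_cat_def)
  show "supremum X \<psi> \<in> obj X" using s by (simp add: is_supremum_def)
qed

lemma yoneda_in_JS:
  assumes "saturated_class J" "qcategory X" "x \<in> obj X"
  shows "yoneda X x \<in> obj (JS J X)"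
  using is_supremum_yoneda[OF assms(2,3)] assms
  by (auto simp: JS_def full_sub_def saturated_class_def)

lemma graph_yoneda:
  assumes "saturated_class J" "qcategory X" "x \<in> obj X" "\<psi> \<in> obj (JS J X)"
  shows "graph (JS J X) (yoneda X) x \<psi> = \<psi> x"
proof -
  have "graph (JS J X) (yoneda X) x \<psi> = hom (presheaf_cat X) (yoneda X x) \<psi>"
    using yoneda_in_JS[OF assms(1-3)] assms(4) by (simp add: graph_def JS_def full_sub_def)
  then show ?thesis using yoneda_lemma[OF assms(2,3) JS_obj(2)[OF assms(1,2,4)]] by simp
qed

lemma way_below_greatest:
  assumes J: "saturated_class J" and X: "qcategory X"
  defines "admissible v \<equiv> distributor X X v \<and>
      dist_le X (JS J X) (dist_comp X (cograph X (supremum X)) v) (graph (JS J X) (yoneda X))"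
  shows "admissible (way_below J X)" "admissible v \<Longrightarrow> dist_le X X v (way_below J X)"
proof -
  note S = JS_obj[OF J X]
  have hX: "hom X a b * hom X b c \<le> hom X a c" if "a \<in> obj X" "b \<in> obj X" "c \<in> obj X" for a b c
    using X that unfolding qcategory_def by blast
  have w: "hom X y (supremum X \<psi>) * way_below J X z y \<le> \<psi> z" if "\<psi> \<in> obj (JS J X)" for \<psi> z y
    using that by (auto simp: way_below_def residual_galois[symmetric] intro: INF_lower)
  have "distributor X X (way_below J X)"
    unfolding distributor_def
  proof (intro ballI)
    fix x' x y y' assume o: "x' \<in> obj X" "x \<in> obj X" "y \<in> obj X" "y' \<in> obj X"
    show "hom X x' x * way_below J X x y * hom X y y' \<le> way_below J X x' y'"
      unfolding way_below_def[of _ _ x' y']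
    proof (rule INF_greatest, unfold residual_galois)
      fix \<psi> assume p: "\<psi> \<in> obj (JS J X)"
      let ?s = "supremum X \<psi>"
      have "hom X y' ?s * (hom X x' x * way_below J X x y * hom X y y') =
            hom X x' x * ((hom X y y' * hom X y' ?s) * way_below J X x y)"
        by (simp add: ac_simps)
      also have "\<dots> \<le> hom X x' x * (hom X y ?s * way_below J X x y)"
        using hX[OF o(3,4) S(4)[OF p]] by (intro mult_mono_q2) auto
      also have "\<dots> \<le> hom X x' x * \<psi> x" using w[OF p] by (intro mult_mono_q)
      also have "\<dots> \<le> \<psi> x'" using S(2)[OF p] o by (simp add: presheaf_iff)
      finally show "hom X y' ?s * (hom X x' x * way_below J X x y * hom X y y') \<le> \<psi> x'" .
    qed
  qed
  then show "admissible (way_below J X)"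
    using w unfolding admissible_def
    by (auto simp: dist_le_def dist_comp_def cograph_def graph_yoneda[OF J X] mult.commute
        intro!: SUP_least)
  assume v: "admissible v"
  show "dist_le X X v (way_below J X)"
    unfolding dist_le_def way_below_def
  proof (intro ballI INF_greatest, unfold residual_galois)
    fix z x \<psi> assume o: "z \<in> obj X" "x \<in> obj X" and p: "\<psi> \<in> obj (JS J X)"
    have "v z x * hom X x (supremum X \<psi>) \<le> dist_comp X (cograph X (supremum X)) v z \<psi>"
      using o by (auto simp: dist_comp_def cograph_def intro: SUP_upper)
    also have "\<dots> \<le> \<psi> z"
      using v o p unfolding admissible_def
      by (auto simp: dist_le_def graph_yoneda[OF J X, symmetric])
    finally show "hom X x (supremum X \<psi>) * v z x \<le> \<psi> z" by (simp add: mult.commute)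
  qed
qed

end

theory Submission
  imports Defs
begin

text \<open>
  If \<open>t\<close> is left adjoint to \<open>\<S>\<close>, then \<open>\<Down>(-, x) = t x\<close>, so \<open>\<Down>\<close> is approximating.
  An approximating \<open>v\<close> exhibits \<open>x\<close> as the supremum of \<open>v(-, x) \<in> J X\<close>; if it is moreover
  \<open>J\<close>-cocontinuous, then \<open>x \<mapsto> v(-, x)\<close> is left adjoint to \<open>\<S>\<close>. Finally, if \<open>\<Down>\<close> is
  approximating, then for every \<open>\<psi> \<in> J\<^sub>S X\<close> the weight \<open>\<psi> \<cdot> \<Down>\<close> lies in \<open>J X\<close> by saturation and
  has the same supremum as \<open>\<psi>\<close>, whence \<open>\<Down>(-, \<S> \<psi>) \<le> \<psi> \<cdot> \<Down>\<close>, which is cocontinuity.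
\<close>

section \<open>Isomorphic objects, uniqueness of suprema, and homs in \<open>JS J X\<close>\<close>

lemma hom_trans:
  assumes "qcategory X" "x \<in> obj X" "y \<in> obj X" "z \<in> obj X"
  shows "hom X x y * hom X y z \<le> hom X x z"
  using assms unfolding qcategory_def by blast

lemma mult_one_le:
  assumes "1 \<le> (b::'q::quantale)"
  shows "a \<le> a * b" "a \<le> b * a"
  using mult_mono_q[OF assms, of a] by (simp_all add: mult.commute)

text \<open>\<open>supremum\<close> is an arbitrary choice, so suprema can be identified only up to
  equivalence; homs do not see the difference.\<close>

lemma hom_iso_cong:
  assumes X: "qcategory X" and o: "x \<in> obj X" "y \<in> obj X" "z \<in> obj X"
    and iso: "1 \<le> hom X x y" "1 \<le> hom X y x"
  shows "hom X x z = hom X y z" "hom X z x = hom X z y"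
proof -
  have "hom X b z \<le> hom X a z" "hom X z a \<le> hom X z b"
    if "a \<in> obj X" "b \<in> obj X" "1 \<le> hom X a b" for a b
    using order.trans[OF mult_one_le(2)[OF that(3)] hom_trans[OF X that(1,2) o(3)]]
      order.trans[OF mult_one_le(1)[OF that(3)] hom_trans[OF X o(3) that(1,2)]] by auto
  then show "hom X x z = hom X y z" "hom X z x = hom X z y"
    using o iso by (blast intro: order.antisym)+
qed

lemma JS_obj_iff: "\<phi> \<in> obj (JS J X) \<longleftrightarrow> \<phi> \<in> J X \<and> (\<exists>s. is_supremum X \<phi> s)"
  by (simp add: JS_def full_sub_def)

lemma is_supremum_iff:
  assumes "qcategory X" "presheaf X \<phi>"
  shows "is_supremum X \<phi> s \<longleftrightarrow>
    s \<in> obj X \<and> (\<forall>x\<in>obj X. hom X s x = (INF z\<in>obj X. residual (\<phi> z) (hom X z x)))"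
  using assms presheaf_yoneda[OF assms(1)]
  by (auto simp: is_supremum_def presheaf_cat_def yoneda_def)

text \<open>Both suprema have the same homs into any object, in particular into \<open>s'\<close>.
  The hypotheses are symmetric in \<open>s\<close> and \<open>s'\<close>, so two uses give an
  equivalence.\<close>

lemma is_supremum_iso:
  assumes X: "qcategory X" and s: "is_supremum X \<phi> s" "is_supremum X \<phi> s'"
  shows "1 \<le> hom X s s'"
proof -
  have "hom X s s' = hom X s' s'"
    using s by (simp add: is_supremum_def)
  moreover have "1 \<le> hom X s' s'"
    using X s(2) unfolding qcategory_def is_supremum_def by blast
  ultimately show ?thesis by simp
qed

lemma hom_JS:
  assumes "saturated_class J" "qcategory X" "\<phi> \<in> obj (JS J X)" "\<psi> \<in> obj (JS J X)"
  shows "hom (JS J X) \<phi> \<psi> = (INF z\<in>obj X. residual (\<phi> z) (\<psi> z))"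
proof -
  have "hom (JS J X) \<phi> \<psi> = hom (presheaf_cat X) \<phi> \<psi>"
    using assms(3,4) by (simp add: JS_def full_sub_def)
  then show ?thesis
    using JS_obj(2)[OF assms(1-3)] JS_obj(2)[OF assms(1,2,4)] by (simp add: presheaf_cat_def)
qed

lemma le_hom_JS:
  assumes "saturated_class J" "qcategory X" "\<phi> \<in> obj (JS J X)" "\<psi> \<in> obj (JS J X)"
  shows "c \<le> hom (JS J X) \<phi> \<psi> \<longleftrightarrow> (\<forall>z\<in>obj X. \<phi> z * c \<le> \<psi> z)"
  unfolding hom_JS[OF assms] by (simp add: le_INF_iff residual_galois)

text \<open>The universal property, evaluated at the supremum itself, turns reflexivity into this
  bound, the inequality of \<open>\<psi>\<close> with the presheaf represented by its
  supremum.\<close>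

lemma weight_le_hom_supremum:
  assumes "saturated_class J" "qcategory X" "\<psi> \<in> obj (JS J X)" "z \<in> obj X"
  shows "\<psi> z \<le> hom X z (supremum X \<psi>)"
proof -
  note S = JS_obj[OF assms(1-3)]
  have "1 \<le> hom X (supremum X \<psi>) (supremum X \<psi>)"
    using assms(2) S(4) by (simp add: qcategory_def)
  also have "\<dots> = (INF z\<in>obj X. residual (\<psi> z) (hom X z (supremum X \<psi>)))"
    using S(3,4) is_supremum_iff[OF assms(2) S(2)] by simp
  finally have "\<psi> z * 1 \<le> hom X z (supremum X \<psi>)"
    using assms(4) by (simp add: le_INF_iff residual_galois)
  then show ?thesis by simp
qed

lemma qfunctor_supremum:
  assumes J: "saturated_class J" and X: "qcategory X"
  shows "qfunctor (JS J X) X (supremum X)"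
  unfolding qfunctor_def
proof (intro conjI ballI)
  show "supremum X \<in> obj (JS J X) \<rightarrow> obj X" using JS_obj(4)[OF J X] by auto
next
  fix \<phi> \<psi> assume o: "\<phi> \<in> obj (JS J X)" "\<psi> \<in> obj (JS J X)"
  note S = JS_obj[OF J X o(1)]
  have "\<phi> z * hom (JS J X) \<phi> \<psi> \<le> hom X z (supremum X \<psi>)" if "z \<in> obj X" for z
    using le_hom_JS[OF J X o, of "hom (JS J X) \<phi> \<psi>"] weight_le_hom_supremum[OF J X o(2) that] that
    by (meson order.refl order.trans)
  then show "hom (JS J X) \<phi> \<psi> \<le> hom X (supremum X \<phi>) (supremum X \<psi>)"
    using S(3) JS_obj(4)[OF J X o(2)] is_supremum_iff[OF X S(2)]
    by (simp add: le_INF_iff residual_galois)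
qed

section \<open>From a left adjoint of the supremum functor to an approximating way-below
  distributor\<close>

text \<open>The adjunction rewrites \<open>hom X x (supremum X \<psi>)\<close> as the hom from
  \<open>t x\<close> to \<open>\<psi>\<close>. The infimum defining \<open>way_below\<close> then
  becomes a Yoneda-type infimum, attained at \<open>\<psi> = t x\<close>.\<close>

lemma way_below_left_adjoint:
  assumes J: "saturated_class J" and X: "qcategory X"
    and t: "left_adjoint X (JS J X) t (supremum X)" and o: "x \<in> obj X" "z \<in> obj X"
  shows "way_below J X z x = t x z"
proof -
  have tx: "t x \<in> obj (JS J X)"
    using t o by (auto simp: left_adjoint_def qfunctor_def)
  have adj: "hom (JS J X) (t x) \<psi> = hom X x (supremum X \<psi>)" if "\<psi> \<in> obj (JS J X)" for \<psi>
    using t o that by (simp add: left_adjoint_def)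
  show ?thesis
  proof (rule order.antisym)
    have "way_below J X z x \<le> residual (hom X x (supremum X (t x))) (t x z)"
      unfolding way_below_def using tx by (rule INF_lower)
    \<comment> \<open>Unit of the adjunction: reflexivity at \<open>t x\<close>, transposed.\<close>
    moreover have "1 \<le> hom X x (supremum X (t x))"
      using adj[OF tx] le_hom_JS[OF J X tx tx, of 1] by simp
    ultimately show "way_below J X z x \<le> t x z"
      unfolding residual_galois using mult_one_le(2) order.trans by blast
    show "t x z \<le> way_below J X z x"
      unfolding way_below_def
    proof (rule INF_greatest, unfold residual_galois)
      fix \<psi> assume p: "\<psi> \<in> obj (JS J X)"
      then show "hom X x (supremum X \<psi>) * t x z \<le> \<psi> z"
        using le_hom_JS[OF J X tx p, of "hom X x (supremum X \<psi>)"] adj[OF p] o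
        by (simp add: mult.commute)
    qed
  qed
qed

lemma J_continuous_imp_approximating:
  assumes J: "saturated_class J" and X: "qcategory X" and c: "J_continuous J X"
  shows "approximating J X (way_below J X)"
proof -
  obtain t where t: "left_adjoint X (JS J X) t (supremum X)"
    using c by (auto simp: J_continuous_def)
  note w = way_below_left_adjoint[OF J X t]
  have tx: "t x \<in> obj (JS J X)" if "x \<in> obj X" for x
    using t that by (auto simp: left_adjoint_def qfunctor_def)
  \<comment> \<open>A genuine equality of functions, since the presheaf \<open>t x\<close> is
    extensional; membership in \<open>J X\<close> thus transfers directly.\<close>
  have "(\<lambda>z\<in>obj X. way_below J X z x) = t x" if x: "x \<in> obj X" for x
    using JS_obj(2)[OF J X tx[OF x]] w[OF x]
    by (auto simp: presheaf_def extensional_def restrict_def)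
  then have "in_class J X X (way_below J X)"
    using way_below_greatest(1)[OF J X] JS_obj(1)[OF J X tx] by (simp add: in_class_def)
  moreover have "(INF z\<in>obj X. residual (way_below J X z x) (hom X z y)) = hom X x y"
    if o: "x \<in> obj X" "y \<in> obj X" for x y
  proof -
    have y: "yoneda X y \<in> obj (JS J X)" by (rule yoneda_in_JS[OF J X o(2)])
    note S = JS_obj[OF J X y] is_supremum_yoneda[OF X o(2)]
    have "(INF z\<in>obj X. residual (way_below J X z x) (hom X z y)) =
        (INF z\<in>obj X. residual (t x z) (yoneda X y z))"
      using w[OF o(1)] by (simp add: yoneda_def)
    also have "\<dots> = hom (JS J X) (t x) (yoneda X y)"
      by (rule hom_JS[OF J X tx[OF o(1)] y, symmetric])
    also have "\<dots> = hom X x (supremum X (yoneda X y))"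
      using t o y by (simp add: left_adjoint_def)
    \<comment> \<open>The chosen supremum of \<open>yoneda X y\<close> need not be \<open>y\<close>,
      only equivalent to it.\<close>
    also have "\<dots> = hom X x y"
      by (rule hom_iso_cong(2)[OF X S(4) o(2,1)]) (rule is_supremum_iso[OF X S(3,5)],
        rule is_supremum_iso[OF X S(5,3)])
    finally show ?thesis .
  qed
  ultimately show ?thesis by (simp add: approximating_def)
qed

section \<open>Composing weights with approximating distributors, and cocontinuity of
  way-below\<close>

lemma comp_weight_in_class:
  assumes J: "saturated_class J" and X: "qcategory X"
    and v: "in_class J X X v" and p: "\<psi> \<in> J X"
  shows "(\<lambda>x\<in>obj X. SUP y\<in>obj X. v x y * \<psi> y) \<in> J X"
proof -
  \<comment> \<open>A weight is a distributor into a one-point category, but saturation of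
    \<open>J\<close> only speaks of categories with objects in one fixed type. So
    \<open>one_cat\<close> is replaced by a point of that type, with \<open>hom\<close> normalised
    off its domain as \<open>qcategory\<close> demands.\<close>
  define Z :: "('a, 'b) qcat"
    where "Z = \<lparr>obj = {undefined}, hom = (\<lambda>x y. if x = undefined \<and> y = undefined then 1 else undefined)\<rparr>"
  have Z: "qcategory Z" by (auto simp: qcategory_def Z_def)
  have pr: "presheaf X \<psi>" using J X p by (auto simp: saturated_class_def presheaf_cat_def)
  have "(\<lambda>x\<in>obj X. \<psi> x) = \<psi>"
    using pr by (simp add: presheaf_def extensional_restrict)
  then have "in_class J X Z (\<lambda>x _. \<psi> x)"
    using pr p by (auto simp: in_class_def distributor_def presheaf_iff Z_def)
  then have "in_class J X Z (dist_comp X (\<lambda>x _. \<psi> x) v)"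
    using J X Z v unfolding saturated_class_def by blast
  then show ?thesis by (simp add: in_class_def dist_comp_def Z_def)
qed

text \<open>By the approximation equation, \<open>hom X z x\<close> in the universal property of
  \<open>\<psi>\<close> may be replaced by an infimum of residuals along \<open>v\<close>. Currying
  these residuals gives the universal property of the composite weight.\<close>

lemma is_supremum_comp_approximating:
  assumes J: "saturated_class J" and X: "qcategory X"
    and a: "approximating J X v" and p: "\<psi> \<in> J X" and s: "is_supremum X \<psi> s"
  shows "is_supremum X (\<lambda>x\<in>obj X. SUP y\<in>obj X. v x y * \<psi> y) s" (is "is_supremum X ?\<theta> s")
proof -
  have pr: "presheaf X \<phi>" if "\<phi> \<in> J X" for \<phi>
    using J X that by (auto simp: saturated_class_def presheaf_cat_def)
  have \<theta>: "presheaf X ?\<theta>"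
    using comp_weight_in_class[OF J X _ p] a by (intro pr) (simp add: approximating_def)
  have "(INF z\<in>obj X. residual (\<psi> z) (hom X z x)) = (INF z\<in>obj X. residual (?\<theta> z) (hom X z x))"
    (is "?L = ?R") if x: "x \<in> obj X" for x
  proof -
    \<comment> \<open>The infima are compared through their lower bounds \<open>c\<close>, where
      residuals become products and the quantifiers can be exchanged.\<close>
    have "c \<le> ?L \<longleftrightarrow> c \<le> ?R" for c
    proof -
      have "c \<le> ?L \<longleftrightarrow> (\<forall>y\<in>obj X. \<psi> y * c \<le> (INF z\<in>obj X. residual (v z y) (hom X z x)))"
        using a x by (simp add: le_INF_iff residual_galois approximating_def)
      also have "\<dots> \<longleftrightarrow> (\<forall>z\<in>obj X. \<forall>y\<in>obj X. c * (v z y * \<psi> y) \<le> hom X z x)"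
        by (auto simp: le_INF_iff residual_galois ac_simps)
      also have "\<dots> \<longleftrightarrow> (\<forall>z\<in>obj X. c * ?\<theta> z \<le> hom X z x)"
        by (simp add: mult_Sup image_image SUP_le_iff)
      also have "\<dots> \<longleftrightarrow> c \<le> ?R"
        by (simp add: le_INF_iff residual_galois mult.commute)
      finally show ?thesis .
    qed
    then show ?thesis by (meson order.antisym order.refl)
  qed
  then show ?thesis
    using s is_supremum_iff[OF X \<theta>] is_supremum_iff[OF X pr[OF p]] by simp
qed

lemma approximating_imp_J_cocontinuous:
  assumes J: "saturated_class J" and X: "qcategory X"
    and a: "approximating J X (way_below J X)"
  shows "J_cocontinuous J X X (way_below J X)"
proof -
  let ?v = "way_below J X"
  have d: "distributor X X ?v" using way_below_greatest(1)[OF J X] by simp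
  have v: "in_class J X X ?v" using a by (simp add: approximating_def)
  have "dist_comp X (cograph X (supremum X)) ?v x \<psi> =
      dist_comp X (graph (JS J X) (yoneda X)) ?v x \<psi>"
    if x: "x \<in> obj X" and p: "\<psi> \<in> obj (JS J X)" for x \<psi>
  proof -
    note S = JS_obj[OF J X p]
    let ?s = "supremum X \<psi>" and ?\<theta> = "\<lambda>x\<in>obj X. SUP y\<in>obj X. ?v x y * \<psi> y"
    have \<theta>: "is_supremum X ?\<theta> ?s"
      by (rule is_supremum_comp_approximating[OF J X a S(1,3)])
    then have \<theta>JS: "?\<theta> \<in> obj (JS J X)"
      using comp_weight_in_class[OF J X v S(1)] by (auto simp: JS_obj_iff)
    \<comment> \<open>The composite weight \<open>?\<theta>\<close> itself serves as test weight in
      the infimum defining \<open>way_below\<close>.\<close>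
    have "hom X ?s (supremum X ?\<theta>) * ?v x ?s \<le> ?\<theta> x"
      unfolding residual_galois[symmetric] way_below_def[of _ _ x ?s]
      by (rule INF_lower[OF \<theta>JS])
    then have interp: "?v x ?s \<le> ?\<theta> x"
      using mult_one_le(2)[OF is_supremum_iso[OF X \<theta> JS_obj(3)[OF J X \<theta>JS]]] order.trans
      by blast
    \<comment> \<open>The distributor law collapses the composite with the cograph of the supremum
      to \<open>?v x ?s\<close>, which \<open>interp\<close> bounds.\<close>
    have "?v x y * hom X y ?s \<le> ?v x ?s" if y: "y \<in> obj X" for y
    proof -
      have "?v x y * hom X y ?s \<le> hom X x x * ?v x y * hom X y ?s"
        using X x mult_one_le(2)[of "hom X x x"] by (intro mult_mono_q2) (auto simp: qcategory_def)
      also have "\<dots> \<le> ?v x ?s" using d x y S(4) by (simp add: distributor_def)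
      finally show ?thesis .
    qed
    then have "(SUP y\<in>obj X. ?v x y * hom X y ?s) \<le> (SUP y\<in>obj X. ?v x y * \<psi> y)"
      using interp x by (auto intro!: SUP_least intro: order.trans)
    moreover have "(SUP y\<in>obj X. ?v x y * \<psi> y) \<le> (SUP y\<in>obj X. ?v x y * hom X y ?s)"
        by (intro SUP_subset_mono mult_mono_q weight_le_hom_supremum[OF J X p]) auto
    ultimately have "(SUP y\<in>obj X. ?v x y * hom X y ?s) = (SUP y\<in>obj X. ?v x y * \<psi> y)"
      by (rule order.antisym)
    then show ?thesis
      using p by (simp add: dist_comp_def cograph_def graph_yoneda[OF J X])
  qed
  then show ?thesis using d by (simp add: J_cocontinuous_def dist_eq_def)
qed

section \<open>From a cocontinuous approximating distributor to a left adjoint\<close>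

lemma J_cocontinuous_imp_J_continuous:
  assumes J: "saturated_class J" and X: "qcategory X"
    and c: "J_cocontinuous J X X v" and a: "approximating J X v"
  shows "J_continuous J X"
proof -
  define t where "t x = (\<lambda>z\<in>obj X. v z x)" for x
  have d: "distributor X X v" using c by (simp add: J_cocontinuous_def)
  have app: "(INF z\<in>obj X. residual (v z x) (hom X z y)) = hom X x y"
    if "x \<in> obj X" "y \<in> obj X" for x y
    using a that by (simp add: approximating_def)
  have tJ: "t x \<in> J X" if "x \<in> obj X" for x
    using a that by (simp add: approximating_def in_class_def t_def)
  then have pr: "presheaf X (t x)" if "x \<in> obj X" for x
    using J X that by (auto simp: saturated_class_def presheaf_cat_def)
  \<comment> \<open>The approximation equation is exactly the universal property of \<open>x\<close>
    as supremum of \<open>t x\<close>.\<close>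
  have sup: "is_supremum X (t x) x" if "x \<in> obj X" for x
    using app that is_supremum_iff[OF X pr[OF that]] by (simp add: t_def)
  then have tJS: "t x \<in> obj (JS J X)" if "x \<in> obj X" for x
    using tJ that by (auto simp: JS_obj_iff)
  have v_le: "v z y \<le> hom X z y" if o: "z \<in> obj X" "y \<in> obj X" for z y
  proof -
    have "1 \<le> (INF z\<in>obj X. residual (v z y) (hom X z y))"
      using app[OF o(2,2)] X o by (simp add: qcategory_def)
    then have "v z y * 1 \<le> hom X z y"
      using o by (simp add: le_INF_iff residual_galois)
    then show ?thesis by simp
  qed
  have "hom X x y \<le> hom (JS J X) (t x) (t y)" if o: "x \<in> obj X" "y \<in> obj X" for x y
    unfolding le_hom_JS[OF J X tJS[OF o(1)] tJS[OF o(2)]]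
  proof
    fix z assume z: "z \<in> obj X"
    have "v z x * hom X x y \<le> hom X z z * v z x * hom X x y"
      using X z mult_one_le(2)[of "hom X z z"] by (intro mult_mono_q2) (auto simp: qcategory_def)
    also have "\<dots> \<le> v z y" using d o z by (simp add: distributor_def)
    finally show "t x z * hom X x y \<le> t y z" using z by (simp add: t_def)
  qed
  then have "qfunctor X (JS J X) t" using tJS by (simp add: qfunctor_def)
  moreover have "hom (JS J X) (t x) \<psi> = hom X x (supremum X \<psi>)"
    if x: "x \<in> obj X" and p: "\<psi> \<in> obj (JS J X)" for x \<psi>
  \<comment> \<open>One inequality is functoriality of the supremum, as \<open>x\<close> is a
    supremum of \<open>t x\<close>; the other is where cocontinuity enters.\<close>
  proof (rule order.antisym)
    note S = JS_obj[OF J X p] and T = JS_obj[OF J X tJS[OF x]]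
    have "hom (JS J X) (t x) \<psi> \<le> hom X (supremum X (t x)) (supremum X \<psi>)"
      using qfunctor_supremum[OF J X] tJS[OF x] p by (simp add: qfunctor_def)
    also have "\<dots> = hom X x (supremum X \<psi>)"
      using is_supremum_iso[OF X] T(3) sup[OF x]
      by (intro hom_iso_cong(1)[OF X T(4) x S(4)]) blast+
    finally show "hom (JS J X) (t x) \<psi> \<le> hom X x (supremum X \<psi>)" .
    show "hom X x (supremum X \<psi>) \<le> hom (JS J X) (t x) \<psi>"
      unfolding le_hom_JS[OF J X tJS[OF x] p]
    proof
      fix z assume z: "z \<in> obj X"
      have "v z x * hom X x (supremum X \<psi>) \<le> dist_comp X (cograph X (supremum X)) v z \<psi>"
        using x by (auto simp: dist_comp_def cograph_def intro: SUP_upper)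
      \<comment> \<open>Cocontinuity trades \<open>hom X y (supremum X \<psi>)\<close> for
        \<open>\<psi> y\<close>; then \<open>v_le\<close> and the presheaf law absorb
        \<open>v\<close>.\<close>
      also have "\<dots> = (SUP y\<in>obj X. v z y * \<psi> y)"
        using c z p by (simp add: J_cocontinuous_def dist_eq_def)
          (simp add: dist_comp_def graph_yoneda[OF J X])
      also have "\<dots> \<le> \<psi> z"
      proof (rule SUP_least)
        fix y assume y: "y \<in> obj X"
        have "v z y * \<psi> y \<le> hom X z y * \<psi> y"
          using v_le[OF z y] by (intro mult_mono_q2) auto
        also have "\<dots> \<le> \<psi> z" using S(2) y z by (simp add: presheaf_iff)
        finally show "v z y * \<psi> y \<le> \<psi> z" .
      qed
      finally show "t x z * hom X x (supremum X \<psi>) \<le> \<psi> z" using z by (simp add: t_def)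
    qed
  qed
  ultimately have "left_adjoint X (JS J X) t (supremum X)"
    using qfunctor_supremum[OF J X] by (simp add: left_adjoint_def)
  then show ?thesis by (auto simp: J_continuous_def)
qed

theorem theorem4p17:
  fixes J :: "('u, 'q::quantale) qcat \<Rightarrow> ('u \<Rightarrow> 'q) set"
    and X :: "('u, 'q) qcat"
  assumes "saturated_class J"
    and "qcategory X"
  shows "(J_continuous J X \<longleftrightarrow> approximating J X (way_below J X)) \<and>
    (approximating J X (way_below J X) \<longleftrightarrow>
      (\<exists>v. J_cocontinuous J X X v \<and> approximating J X v))"
  using J_continuous_imp_approximating[OF assms] approximating_imp_J_cocontinuous[OF assms]
    J_cocontinuous_imp_J_continuous[OF assms]
  by blast

end
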